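(* Let $L$ be a (real) vector lattice with a distinguished strong unit $e>0$, and let $H:L\rightarrow\mathbb{R}$ be a unital linear functional, i.e. a linear functional with $H(e)=1$. Then the following are equivalent. (1) $H$ is unit preserving, i.e. $H(u)\neq 0$ for every strong unit $u\in L$. (2) $H$ acts as a lattice homomorphism on the set of all strong units of $L$, i.e. $|H(u)|=H(|u|)$ for every strong unit $u\in L$. (3) $H$ acts as a lattice homomorphism on any clean vector subspace of $L$, i.e. for every vector subspace $E$ of $L$ all of whose elements are clean, $|H(x)|=H(|x|)$ for all $x\in E$.
   Context: $L$ is a real vector lattice (Riesz space); no Archimedean assumption is stated. An element $u\in L$ (not necessarily positive) is a strong unit if for every $x\in L$ there is a real $\alpha>0$ with $|x|\leq\alpha|u|$. A strong unit $e>0$ of $L$ is fixed. A component of $L$ is an element $p\in L$ with $p\wedge(e-p)=0$. An element $x\in L$ is clean if there exist a component $p$ of $L$ and a strong unit $u$ of $L$ with $x=p+u$. A subset $E\subseteq L$ is clean if every element of $E$ is clean (in $L$). *)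

theory Defs
  imports Complex_Main "HOL-Library.Lattice_Algebras"
begin

text \<open>
  A real vector lattice is a type of sort
  \<open>{ordered_real_vector, lattice_ab_group_add_abs}\<close>. The Archimedean property is not part
  of this sort, and \<open>\<bar>x\<bar> = sup x (- x)\<close> is the class axiom \<open>abs_lattice\<close>.
\<close>

text \<open>Strong units are not required to be positive.\<close>

definition strong_unit :: "'a::{ordered_real_vector, lattice_ab_group_add_abs} \<Rightarrow> bool"
  where "strong_unit u \<longleftrightarrow> (\<forall>x. \<exists>\<alpha>>0. \<bar>x\<bar> \<le> \<alpha> *\<^sub>R \<bar>u\<bar>)"

definition is_component ::
  "'a::{ordered_real_vector, lattice_ab_group_add_abs} \<Rightarrow> 'a \<Rightarrow> bool"
  where "is_component e p \<longleftrightarrow> inf p (e - p) = 0"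

definition clean :: "'a::{ordered_real_vector, lattice_ab_group_add_abs} \<Rightarrow> 'a \<Rightarrow> bool"
  where "clean e x \<longleftrightarrow> (\<exists>p u. is_component e p \<and> strong_unit u \<and> x = p + u)"

text \<open>The witnesses \<open>p\<close> and \<open>u\<close> range over the whole lattice, not over \<open>E\<close>.\<close>

definition clean_set :: "'a::{ordered_real_vector, lattice_ab_group_add_abs} \<Rightarrow> 'a set \<Rightarrow> bool"
  where "clean_set e E \<longleftrightarrow> (\<forall>x\<in>E. clean e x)"

end

theory Submission imports Defs begin

text \<open>
  Both (1) and (2) force \<open>H\<close> to be positive, because \<open>x + t *\<^sub>R e\<close> is a strong unit for all
  \<open>x \<ge> 0\<close> and \<open>t > 0\<close>. For a positive functional, \<open>\<bar>H x\<bar> = H \<bar>x\<bar>\<close> says that \<open>H\<close> kills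
  \<open>x\<^sup>+\<close> or \<open>x\<^sup>-\<close>. If it killed neither for a strong unit \<open>u\<close>, then a suitable
  \<open>u\<^sup>+ - s *\<^sub>R u\<^sup>-\<close> with \<open>s > 0\<close> would be a strong unit in the kernel of \<open>H\<close>. If it killed
  neither for some \<open>x\<close> in a clean subspace, write \<open>t *\<^sub>R x = p + u\<close> with \<open>t\<close> large: since
  \<open>0 \<le> p \<le> e\<close>, \<open>H\<close> kills neither \<open>u\<^sup>+\<close> nor \<open>u\<^sup>-\<close>. Conversely, every line spanned by a strong
  unit is a clean subspace.
\<close>

section \<open>Disjoint elements and their multiples\<close>

lemma abs_diff_of_disjoint:
  fixes a b :: "'a::lattice_ab_group_add_abs"
  assumes "inf a b = 0"
  shows "\<bar>a - b\<bar> = a + b"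
proof -
  \<comment> \<open>Translating \<open>inf (a - b) 0\<close> by \<open>b\<close> brings in
    \<open>inf a b\<close>, so disjointness makes \<open>a\<close> and \<open>b\<close> the positive
    and negative parts of \<open>a - b\<close>.\<close>
  have "nprt (a - b) = inf a b + - b"
    unfolding nprt_def by (simp only: add_inf_distrib_right) simp
  then have n: "nprt (a - b) = - b"
    using assms by simp
  then have "pprt (a - b) = a"
    using prts[of "a - b"] by (simp add: algebra_simps)
  then show ?thesis
    using n by (simp add: abs_prts)
qed

lemma inf_pprt_uminus_nprt:
  fixes u :: "'a::lattice_ab_group_add_abs"
  shows "inf (pprt u) (- nprt u) = 0"
proof -
  have "inf (pprt u) (- nprt u) = inf (u - nprt u) (0 - nprt u)"
    by (metis add_diff_cancel_right' diff_0 prts)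
  also have "\<dots> = inf u 0 - nprt u"
    by (metis add_inf_distrib_right diff_conv_add_uminus)
  finally show ?thesis by (simp add: nprt_def)
qed

lemma inf_scaleR_of_disjoint:
  fixes a b :: "'a::{ordered_real_vector, lattice_ab_group_add_abs}"
  assumes "inf a b = 0" and "s > 0"
  shows "inf a (s *\<^sub>R b) = 0"
proof (rule antisym)
  have ab: "0 \<le> a" "0 \<le> b"
    using assms(1) by (metis inf.cobounded1 inf.cobounded2)+
  then show "0 \<le> inf a (s *\<^sub>R b)"
    using assms(2) by (simp add: scaleR_nonneg_nonneg)
  \<comment> \<open>Both \<open>a\<close> and \<open>s *\<^sub>R b\<close> lie below
    \<open>c\<close> times \<open>a\<close> and \<open>b\<close> respectively, so dividing their
    infimum by \<open>c\<close> leads back to \<open>inf a b\<close>.\<close>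
  define c where "c = max 1 s"
  have c: "c \<ge> 1" "c \<ge> s" "c > 0" by (auto simp: c_def)
  have "a \<le> c *\<^sub>R a" "s *\<^sub>R b \<le> c *\<^sub>R b"
    using ab c scaleR_right_mono[of 1 c a] scaleR_right_mono[of s c b] by auto
  then have "inf a (s *\<^sub>R b) \<le> c *\<^sub>R a" "inf a (s *\<^sub>R b) \<le> c *\<^sub>R b"
    by (auto intro: order_trans[OF inf.cobounded1] order_trans[OF inf.cobounded2])
  then have "inf a (s *\<^sub>R b) /\<^sub>R c \<le> inf a b"
    using c by (simp add: pos_divideR_le_eq)
  then show "inf a (s *\<^sub>R b) \<le> 0"
    using assms(1) c by (simp add: pos_divideR_le_eq)
qed

section \<open>Constructing strong units\<close>

lemma strong_unit_dominating:
  assumes "strong_unit u" and "c > 0" and "c *\<^sub>R \<bar>u\<bar> \<le> \<bar>v\<bar>"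
  shows "strong_unit v"
  unfolding strong_unit_def
proof
  fix x
  obtain \<alpha> where \<alpha>: "\<alpha> > 0" "\<bar>x\<bar> \<le> \<alpha> *\<^sub>R \<bar>u\<bar>"
    using assms(1) unfolding strong_unit_def by blast
  have "\<alpha> *\<^sub>R \<bar>u\<bar> = (\<alpha> / c) *\<^sub>R (c *\<^sub>R \<bar>u\<bar>)"
    using assms(2) by simp
  also have "\<dots> \<le> (\<alpha> / c) *\<^sub>R \<bar>v\<bar>"
    using assms \<alpha> by (intro scaleR_left_mono) auto
  finally show "\<exists>\<alpha>>0. \<bar>x\<bar> \<le> \<alpha> *\<^sub>R \<bar>v\<bar>"
    using \<alpha> assms(2) by (meson divide_pos_pos order_trans)
qed

lemma strong_unit_scaleR:
  assumes "strong_unit u" and "t \<noteq> 0"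
  shows "strong_unit (t *\<^sub>R u)"
proof -
  have *: "strong_unit (t *\<^sub>R u)" if "t > 0" for t
  proof (rule strong_unit_dominating[OF assms(1) that])
    have "\<bar>u\<bar> \<le> \<bar>t *\<^sub>R u\<bar> /\<^sub>R t"
    proof (rule abs_leI)
      show "u \<le> \<bar>t *\<^sub>R u\<bar> /\<^sub>R t"
        using that by (simp add: pos_le_divideR_eq abs_ge_self)
      show "- u \<le> \<bar>t *\<^sub>R u\<bar> /\<^sub>R t"
        using that by (simp add: pos_le_divideR_eq abs_ge_minus_self)
    qed
    then show "t *\<^sub>R \<bar>u\<bar> \<le> \<bar>t *\<^sub>R u\<bar>"
      using that by (simp add: pos_le_divideR_eq)
  qed
  have "strong_unit (- v) = strong_unit v" for v :: 'a
    by (simp add: strong_unit_def)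
  then show ?thesis
    using *[of t] *[of "- t"] assms(2) by (cases "t > 0") auto
qed

lemma strong_unit_add_pos:
  fixes e x :: "'a::{ordered_real_vector, lattice_ab_group_add_abs}"
  assumes "strong_unit e" and "e \<ge> 0" and "x \<ge> 0" and "t > 0"
  shows "strong_unit (x + t *\<^sub>R e)"
proof (rule strong_unit_dominating[OF assms(1,4)])
  have "0 \<le> t *\<^sub>R e" using assms by (simp add: scaleR_nonneg_nonneg)
  then show "t *\<^sub>R \<bar>e\<bar> \<le> \<bar>x + t *\<^sub>R e\<bar>"
    using assms by (simp add: add_nonneg_nonneg)
qed

section \<open>Positive functionals\<close>

lemma linear_prts:
  fixes H :: "'a::{ordered_real_vector, lattice_ab_group_add_abs} \<Rightarrow> real"
  assumes "linear H"
  shows "H x = H (pprt x) - H (- nprt x)" and "H \<bar>x\<bar> = H (pprt x) + H (- nprt x)"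
proof -
  show "H x = H (pprt x) - H (- nprt x)"
    using linear_add[OF assms] linear_neg[OF assms] prts[of x]
    by (metis diff_minus_eq_add)
  show "H \<bar>x\<bar> = H (pprt x) + H (- nprt x)"
    using linear_add[OF assms, of "pprt x" "- nprt x"] abs_prts[of x] by simp
qed

text \<open>By positivity this is a fact about reals: for nonnegative \<open>a\<close> and
  \<open>b\<close>, \<open>\<bar>a - b\<bar> = a + b\<close> exactly when one of them
  vanishes.\<close>

lemma positive_abs_iff:
  fixes H :: "'a::{ordered_real_vector, lattice_ab_group_add_abs} \<Rightarrow> real"
  assumes "linear H" and "\<And>x. x \<ge> 0 \<Longrightarrow> H x \<ge> 0"
  shows "\<bar>H x\<bar> = H \<bar>x\<bar> \<longleftrightarrow> H (pprt x) = 0 \<or> H (- nprt x) = 0"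
proof -
  have "H (pprt x) \<ge> 0" "H (- nprt x) \<ge> 0"
    by (auto intro: assms(2))
  then show ?thesis
    unfolding linear_prts[OF assms(1), of x] by auto
qed

lemma linear_mono_of_positive:
  fixes H :: "'a::{ordered_real_vector, lattice_ab_group_add_abs} \<Rightarrow> real"
  assumes "linear H" and "\<And>x. x \<ge> 0 \<Longrightarrow> H x \<ge> 0" and "x \<le> y"
  shows "H x \<le> H y"
  using assms(2)[of "y - x"] assms(3) linear_diff[OF assms(1), of y x] by simp

lemma positive_of_unit_preserving:
  fixes e :: "'a::{ordered_real_vector, lattice_ab_group_add_abs}"
    and H :: "'a \<Rightarrow> real"
  assumes "strong_unit e" and "e \<ge> 0" and "linear H" and "H e = 1"
    and "\<And>u. strong_unit u \<Longrightarrow> H u \<noteq> 0" and "x \<ge> 0"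
  shows "H x \<ge> 0"
proof (rule ccontr)
  assume "\<not> H x \<ge> 0"
  \<comment> \<open>The coefficient \<open>- H x\<close> is positive and cancels \<open>H x\<close>,
    because \<open>H e = 1\<close>.\<close>
  then have "strong_unit (x + (- H x) *\<^sub>R e)"
    using assms by (intro strong_unit_add_pos) auto
  moreover have "H (x + (- H x) *\<^sub>R e) = 0"
    using assms(4) by (simp only: linear_add[OF assms(3)] linear_scale[OF assms(3)]) simp
  ultimately show False using assms(5) by blast
qed

text \<open>The element \<open>x + t *\<^sub>R e\<close> is a positive strong unit, hence its own
  absolute value, so \<open>H x + t\<close> is nonnegative; then \<open>t\<close> tends to
  0.\<close>

lemma positive_of_abs_strong_unit:
  fixes e :: "'a::{ordered_real_vector, lattice_ab_group_add_abs}"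
    and H :: "'a \<Rightarrow> real"
  assumes "strong_unit e" and "e \<ge> 0" and "linear H" and "H e = 1"
    and "\<And>u. strong_unit u \<Longrightarrow> \<bar>H u\<bar> = H \<bar>u\<bar>" and "x \<ge> 0"
  shows "H x \<ge> 0"
proof (rule field_le_epsilon)
  fix t :: real assume t: "t > 0"
  have "x + t *\<^sub>R e \<ge> 0"
    using assms(2,6) t by (simp add: add_nonneg_nonneg scaleR_nonneg_nonneg)
  then have "\<bar>H (x + t *\<^sub>R e)\<bar> = H (x + t *\<^sub>R e)"
    using assms(5)[OF strong_unit_add_pos[OF assms(1,2,6) t]] by simp
  then have "H (x + t *\<^sub>R e) \<ge> 0" by linarith
  then show "0 \<le> H x + t"
    using assms(4) by (simp add: linear_add[OF assms(3)] linear_scale[OF assms(3)])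
qed

section \<open>The implications between the three conditions\<close>

lemma abs_strong_unit_of_unit_preserving:
  fixes H :: "'a::{ordered_real_vector, lattice_ab_group_add_abs} \<Rightarrow> real"
  assumes "linear H" and pos: "\<And>x. x \<ge> 0 \<Longrightarrow> H x \<ge> 0"
    and nz: "\<And>u. strong_unit u \<Longrightarrow> H u \<noteq> 0" and "strong_unit u"
  shows "\<bar>H u\<bar> = H \<bar>u\<bar>"
proof (rule ccontr)
  define a where "a = pprt u"
  define b where "b = - nprt u"
  assume "\<bar>H u\<bar> \<noteq> H \<bar>u\<bar>"
  moreover have ab: "a \<ge> 0" "b \<ge> 0" by (auto simp: a_def b_def)
  ultimately have H: "H a > 0" "H b > 0"
    using positive_abs_iff[OF assms(1) pos, of u] pos[of a] pos[of b]
    by (auto simp: a_def b_def)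
  \<comment> \<open>This ratio puts \<open>a - s *\<^sub>R b\<close> in the kernel of
    \<open>H\<close>.\<close>
  define s where "s = H a / H b"
  have s: "s > 0" using H by (simp add: s_def)
  have u: "\<bar>u\<bar> = a + b" by (simp add: a_def b_def abs_prts)
  have "inf a (s *\<^sub>R b) = 0"
    using inf_scaleR_of_disjoint[OF inf_pprt_uminus_nprt s] by (simp add: a_def b_def)
  then have v: "\<bar>a - s *\<^sub>R b\<bar> = a + s *\<^sub>R b"
    by (rule abs_diff_of_disjoint)
  \<comment> \<open>The disjoint parts only get rescaled, by 1 and by \<open>s\<close>, so the
    smaller factor bounds the new absolute value from below by a multiple of
    \<open>\<bar>u\<bar>\<close>.\<close>
  have "min 1 s *\<^sub>R a \<le> 1 *\<^sub>R a" "min 1 s *\<^sub>R b \<le> s *\<^sub>R b"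
    using ab by (auto intro: scaleR_right_mono simp del: scaleR_one)
  then have "min 1 s *\<^sub>R \<bar>u\<bar> \<le> \<bar>a - s *\<^sub>R b\<bar>"
    unfolding u v scaleR_add_right by (simp add: add_mono)
  then have "strong_unit (a - s *\<^sub>R b)"
    using s by (intro strong_unit_dominating[OF assms(4), of "min 1 s"]) auto
  moreover have "H (a - s *\<^sub>R b) = 0"
    using H by (simp add: linear_diff[OF assms(1)] linear_scale[OF assms(1)] s_def)
  ultimately show False using nz by blast
qed

text \<open>A multiple of \<open>\<bar>u\<bar>\<close> dominates \<open>e\<close>, so
  \<open>H \<bar>u\<bar> = 0\<close> would contradict \<open>H e > 0\<close>.\<close>

lemma unit_preserving_of_abs_strong_unit:
  fixes e :: "'a::{ordered_real_vector, lattice_ab_group_add_abs}"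
    and H :: "'a \<Rightarrow> real"
  assumes "linear H" and pos: "\<And>x. x \<ge> 0 \<Longrightarrow> H x \<ge> 0" and "H e > 0"
    and "\<bar>H u\<bar> = H \<bar>u\<bar>" and "strong_unit u"
  shows "H u \<noteq> 0"
proof
  assume "H u = 0"
  obtain \<alpha> where "\<bar>e\<bar> \<le> \<alpha> *\<^sub>R \<bar>u\<bar>"
    using assms(5) unfolding strong_unit_def by blast
  then have "e \<le> \<alpha> *\<^sub>R \<bar>u\<bar>"
    using abs_ge_self order_trans by blast
  then have "H e \<le> \<alpha> * H \<bar>u\<bar>"
    using linear_mono_of_positive[OF assms(1) pos] by (metis linear_scale[OF assms(1)] real_scaleR_def)
  then show False using assms(3,4) \<open>H u = 0\<close> by simp
qed

lemma abs_of_clean_multiples: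
  fixes e x :: "'a::{ordered_real_vector, lattice_ab_group_add_abs}"
    and H :: "'a \<Rightarrow> real"
  assumes "linear H" and pos: "\<And>x. x \<ge> 0 \<Longrightarrow> H x \<ge> 0"
    and hom: "\<And>u. strong_unit u \<Longrightarrow> \<bar>H u\<bar> = H \<bar>u\<bar>"
    and "\<And>t. t > 0 \<Longrightarrow> clean e (t *\<^sub>R x)"
  shows "\<bar>H x\<bar> = H \<bar>x\<bar>"
proof (rule ccontr)
  assume "\<bar>H x\<bar> \<noteq> H \<bar>x\<bar>"
  moreover have "H (pprt x) \<ge> 0" "H (- nprt x) \<ge> 0"
    by (auto intro: pos)
  ultimately have H: "H (pprt x) > 0" "H (- nprt x) > 0"
    using positive_abs_iff[OF assms(1) pos, of x] by auto
  \<comment> \<open>Now \<open>t * H (pprt x)\<close> exceeds \<open>H e\<close>, hence also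
    \<open>H p\<close> for any component \<open>p\<close>. The absolute value keeps \<open>t\<close>
    positive before anything is known about the sign of \<open>H e\<close>.\<close>
  define t where "t = (\<bar>H e\<bar> + 1) / H (pprt x)"
  have t: "t > 0" using H by (auto simp: t_def intro: divide_pos_pos)
  obtain p u where p: "inf p (e - p) = 0" and u: "strong_unit u" and x: "t *\<^sub>R x = p + u"
    using assms(4)[OF t] unfolding clean_def is_component_def by blast
  have p0: "0 \<le> p" and pe: "p \<le> e"
    using p by (metis inf.cobounded1, metis inf.cobounded2 diff_ge_0_iff_ge)
  have mono: "y \<le> z \<Longrightarrow> H y \<le> H z" for y z
    using linear_mono_of_positive[OF assms(1) pos] .
  \<comment> \<open>Since \<open>pprt u + p\<close> is an upper bound of both
    \<open>t *\<^sub>R x\<close> and 0, it bounds \<open>t *\<^sub>R pprt x\<close>.\<close>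
  have "pprt x \<le> (pprt u + p) /\<^sub>R t"
    unfolding pprt_def[of x]
  proof (rule sup_least)
    have "t *\<^sub>R x \<le> pprt u + p"
      unfolding x by (simp add: pprt_def add.commute)
    then show "x \<le> (pprt u + p) /\<^sub>R t"
      using t by (simp add: pos_le_divideR_eq)
    show "0 \<le> (pprt u + p) /\<^sub>R t"
      using t p0 by (simp add: scaleR_nonneg_nonneg add_nonneg_nonneg)
  qed
  then have "t *\<^sub>R pprt x \<le> pprt u + p"
    using t by (simp add: pos_le_divideR_eq)
  then have "t * H (pprt x) \<le> H (pprt u) + H p"
    using mono by (metis linear_add[OF assms(1)] linear_scale[OF assms(1)] real_scaleR_def)
  moreover have "t * H (pprt x) = \<bar>H e\<bar> + 1"
    using H by (simp add: t_def)
  ultimately have 1: "H (pprt u) > 0"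
    using mono[OF pe] by linarith
  \<comment> \<open>Adding \<open>p \<ge> 0\<close> to \<open>u\<close> can only shrink the negative
    part, so here any \<open>t > 0\<close> works.\<close>
  have "nprt u /\<^sub>R t \<le> nprt x"
    unfolding nprt_def[of x]
  proof (rule inf_greatest)
    have "nprt u \<le> p + u"
      using p0 by (simp add: nprt_def add_increasing inf.coboundedI1)
    then show "nprt u /\<^sub>R t \<le> x"
      using t x by (simp add: pos_divideR_le_eq)
    show "nprt u /\<^sub>R t \<le> 0"
      using t by (simp add: pos_divideR_le_eq)
  qed
  then have "H (- nprt x) \<le> H ((- nprt u) /\<^sub>R t)"
    by (intro mono) simp
  also have "\<dots> = H (- nprt u) / t"
    by (simp only: linear_scale[OF assms(1)]) (simp add: divide_inverse mult.commute)
  finally have 2: "H (- nprt u) \<noteq> 0"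
    using H by auto
  show False
    using hom[OF u] positive_abs_iff[OF assms(1) pos, of u] 1 2 by simp
qed

lemma clean_set_span_strong_unit:
  fixes e u :: "'a::{ordered_real_vector, lattice_ab_group_add_abs}"
  assumes "strong_unit e" and "e \<ge> 0" and "strong_unit u"
  shows "clean_set e (span {u})"
  unfolding clean_set_def
proof
  fix y assume "y \<in> span {u}"
  then obtain t where y: "y = t *\<^sub>R u"
    by (auto simp: span_singleton)
  show "clean e y"
  proof (cases "t = 0")
    case True
    \<comment> \<open>The zero vector needs a nontrivial decomposition: \<open>e\<close> is a
      component as \<open>inf e 0 = 0\<close>, and \<open>- e\<close> is a strong unit.\<close>
    have "strong_unit (- e)" "is_component e e" "y = e + - e"
      using assms True y by (auto simp: strong_unit_def is_component_def inf_absorb2)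
    then show ?thesis unfolding clean_def by blast
  next
    case False
    \<comment> \<open>A nonzero multiple of \<open>u\<close> is itself a strong unit, so the
      component can be 0.\<close>
    have "strong_unit y" "is_component e 0" "y = 0 + y"
      using assms False y by (auto simp: strong_unit_scaleR is_component_def inf_absorb1)
    then show ?thesis unfolding clean_def by blast
  qed
qed

theorem theorem2:
  fixes e :: "'a::{ordered_real_vector, lattice_ab_group_add_abs}"
    and H :: "'a \<Rightarrow> real"
  assumes "strong_unit e" and "e > 0"
    and "linear H" and "H e = 1"
  shows "((\<forall>u. strong_unit u \<longrightarrow> H u \<noteq> 0) \<longleftrightarrow>
          (\<forall>u. strong_unit u \<longrightarrow> \<bar>H u\<bar> = H \<bar>u\<bar>)) \<and>
         ((\<forall>u. strong_unit u \<longrightarrow> \<bar>H u\<bar> = H \<bar>u\<bar>) \<longleftrightarrow>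
          (\<forall>E. subspace E \<and> clean_set e E \<longrightarrow> (\<forall>x\<in>E. \<bar>H x\<bar> = H \<bar>x\<bar>)))"
    (is "(?preserving \<longleftrightarrow> ?hom) \<and> (?hom \<longleftrightarrow> ?clean)")
proof (intro conjI iffI)
  have e: "e \<ge> 0" using assms(2) by simp
  note pos1 = positive_of_unit_preserving[OF assms(1) e assms(3,4)]
  note pos2 = positive_of_abs_strong_unit[OF assms(1) e assms(3,4)]
  show ?hom if ?preserving
    using that abs_strong_unit_of_unit_preserving[OF assms(3) pos1] by blast
  show ?preserving if ?hom
    using that unit_preserving_of_abs_strong_unit[OF assms(3) pos2, of e] assms(4) by simp
  show ?clean if ?hom
  proof (intro allI impI ballI)
    fix E x assume E: "subspace E \<and> clean_set e E" and "x \<in> E"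
    then have "clean e (t *\<^sub>R x)" for t
      by (simp add: clean_set_def subspace_scale)
    then show "\<bar>H x\<bar> = H \<bar>x\<bar>"
      using that abs_of_clean_multiples[OF assms(3) pos2] by blast
  qed
  show ?hom if ?clean
    \<comment> \<open>The condition on clean subspaces is applied to the line through the given
      strong unit.\<close>
    using that clean_set_span_strong_unit[OF assms(1) e] subspace_span span_base
    by (metis insertI1)
qed

end
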